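(* Fix a tuple $\mu=(\mu_1,\ldots,\mu_n)$ of positive integers with sum $d$. Then \[ H_{g;\mu}\sim \frac{2}{d!\,\mu_1\cdots\mu_n}\binom{d}{2}^{d+2g-2+n}\qquad\text{as } g\to\infty . \]
   Context: For an integer $g$ and a tuple $\mu=(\mu_1,\ldots,\mu_n)$ of positive integers, the Hurwitz number $H_{g;\mu}$ is the weighted count of genus $g$ connected branched covers $f:\Sigma\to\mathbb{CP}^1$ with ramification profile $\mu$ over $\infty$, simple ramification over $|\mu|+2g-2+n$ fixed prescribed points of $\mathbb{CP}^1$, and no other branching; the preimages of $\infty$ are labelled $1,\ldots,n$ so that the point labelled $i$ has ramification index $\mu_i$. Isomorphisms are Riemann surface isomorphisms $\phi$ with $f=\tilde f\circ\phi$ preserving these labels, and each cover is counted with weight $1/|\mathrm{Aut}|$. Equivalently, $H_{g;\mu}$ equals $\frac{|\mathrm{Aut}(\mu)|}{|\mu|!}$ times the number of tuples $(\tau_1,\ldots,\tau_{|\mu|+2g-2+n})$ of transpositions in $S_{|\mu|}$ generating a transitive subgroup whose product has cycle type $\mu$, where $\mathrm{Aut}(\mu)$ is the group of permutations of the entries of $\mu$ fixing it. The notation $a_g\sim b_g$ means $a_g/b_g\to 1$. *)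

theory Defs
  imports
    Complex_Main
    "HOL-Library.Multiset"
    "HOL-Library.Landau_Symbols"
    "HOL-Combinatorics.Orbits"
    "HOL-Algebra.Generated_Groups"
    "HOL-Algebra.Sym_Groups"
begin

definition transpositions :: "nat \<Rightarrow> (nat \<Rightarrow> nat) set" where
  "transpositions d = {transpose a b | a b. a \<in> {1..d} \<and> b \<in> {1..d} \<and> a \<noteq> b}"

(* Fixed points contribute parts equal to 1: if p fixes x then orbit p x = {x}. *)
definition cycle_type :: "nat \<Rightarrow> (nat \<Rightarrow> nat) \<Rightarrow> nat multiset" where
  "cycle_type d p = image_mset card (mset_set (orbit p ` {1..d}))"

definition transitive_subgroup :: "nat \<Rightarrow> (nat \<Rightarrow> nat) set \<Rightarrow> bool" where
  "transitive_subgroup d G \<longleftrightarrow>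
     subgroup G (sym_group d) \<and> (\<forall>x\<in>{1..d}. \<forall>y\<in>{1..d}. \<exists>p\<in>G. p x = y)"

definition tuple_Aut :: "nat list \<Rightarrow> (nat \<Rightarrow> nat) set" where
  "tuple_Aut \<mu> =
     {\<sigma>. \<sigma> permutes {..<length \<mu>} \<and> (\<forall>i<length \<mu>. \<mu> ! \<sigma> i = \<mu> ! i)}"

(* Number of simple branch points, |mu| + 2g - 2 + n; the truncated subtraction is exact
   whenever mu is a nonempty tuple of positive integers. *)
definition num_branch :: "nat \<Rightarrow> nat list \<Rightarrow> nat" where
  "num_branch g \<mu> = sum_list \<mu> + 2 * g + length \<mu> - 2"

definition hurwitz_tuples :: "nat \<Rightarrow> nat list \<Rightarrow> (nat \<Rightarrow> nat) list set" where
  "hurwitz_tuples g \<mu> =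
     {\<tau>. length \<tau> = num_branch g \<mu> \<and>
          set \<tau> \<subseteq> transpositions (sum_list \<mu>) \<and>
          transitive_subgroup (sum_list \<mu>) (generate (sym_group (sum_list \<mu>)) (set \<tau>)) \<and>
          cycle_type (sum_list \<mu>) (foldr (\<circ>) \<tau> id) = mset \<mu>}"

(* Connected Hurwitz number with labelled preimages of infinity, through the monodromy
   description of branched covers of the sphere. *)
definition hurwitz :: "nat \<Rightarrow> nat list \<Rightarrow> real" where
  "hurwitz g \<mu> =
     real (card (tuple_Aut \<mu>)) / fact (sum_list \<mu>) * real (card (hurwitz_tuples g \<mu>))"

end

theory Submission
  imports Defs
begin

text \<open>
  Let \<open>k\<close> be the number of branch points and \<open>C\<close> the set of permutations of cycle type \<open>\<mu>\<close>. The product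
  of \<open>k\<close> uniformly random transpositions has sign \<open>(-1)^k\<close>, which is the sign of the elements of
  \<open>C\<close>. Averaging over a fixed even number of further transpositions contracts the oscillation of a
  function on a coset of the alternating group, so the product equidistributes in the coset: it
  falls into \<open>C\<close> with probability tending to \<open>2 |C| / d!\<close>. Tuples that miss some transposition are
  exponentially rare, and all others generate a transitive group. Finally
  \<open>|C| = d! / (|Aut(\<mu>)| \<mu>\<^sub>1 \<cdots> \<mu>\<^sub>n)\<close>.
\<close>

section \<open>Permutations with marked cycles\<close>

text \<open>The sign of a product of k transpositions is fixed by k, so its distribution never
  approaches the uniform one on the whole symmetric group; only starting points of equal sign are
  ever compared. This parity has to match that of the class: k and d + n agree modulo 2 for every g,
  since the genus enters through 2g. Both the size of the class and its sign are read off from one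
  auxiliary object, permutations with a chosen point in each cycle. There are d! of these whatever
  \<mu> is, and the number of choices over one permutation contains the factor |Aut(\<mu>)|, which
  therefore cancels against the automorphism factor in the Hurwitz number.\<close>

lemma permutes_orbit_eq:
  assumes "p permutes A" "finite A" "y \<in> orbit p x"
  shows "orbit p y = orbit p x"
  using orbit_cyclic_eq3[OF cyclic_on_orbit[OF assms(1,2)] assms(3)] .

lemma permutes_self_in_orbit:
  assumes "p permutes A" "finite A"
  shows "x \<in> orbit p x"
  by (rule permutation_self_in_orbit[OF permutes_imp_permutation[OF assms(2,1)]])

text \<open>This removes \<open>x\<close> from its cycle: the predecessor of \<open>x\<close> is
  sent straight to \<open>p x\<close>, and \<open>x\<close> becomes a fixed point.\<close>

lemma permutes_transpose_image_comp:
  assumes "p permutes A" "x \<in> A"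
  shows "transpose x (p x) \<circ> p permutes (A - {x})"
proof -
  have "transpose x (p x) \<circ> p permutes A"
    using assms by (intro permutes_compose permutes_swap_id) (auto simp: permutes_in_image)
  then show ?thesis by (rule permutes_superset) simp
qed

text \<open>The inverse of that removal: the point that \<open>q\<close> sends to \<open>y\<close>
  now goes to \<open>x\<close>, and \<open>x\<close> goes to \<open>y\<close>, so \<open>x\<close>
  is inserted just before \<open>y\<close>.\<close>

lemma orbit_transpose_comp_new:
  assumes q: "q permutes B" and B: "finite B" and x: "x \<notin> B" and y: "y \<in> B"
  shows "orbit (transpose x y \<circ> q) x = insert x (orbit q y)"
proof -
  let ?p = "transpose x y \<circ> q"
  have p: "?p permutes insert x B"
    by (intro permutes_compose permutes_swap_id permutes_subset[OF q]) (use y in auto)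
  have qx: "q x = x" using q x by (simp add: permutes_not_in)
  have px: "?p x = y" using qx by simp
  have sub: "orbit q y \<subseteq> B" using q y by (rule permutes_orbit_subset)
  have yy: "y \<in> orbit q y" using permutes_self_in_orbit[OF q B] .
  have "z \<in> insert x (orbit q y)" if "z \<in> orbit ?p x" for z
    using that
  proof induct
    case base
    then show ?case using px yy by simp
  next
    case (step z)
    have "z = x \<or> q z \<in> orbit q y" using step by (auto intro: orbit.step)
    then show ?case using px yy by (auto simp: transpose_def)
  qed
  moreover have "z \<in> orbit ?p x" if "z \<in> orbit q y" for z
  proof -
    have *: "q z \<in> orbit ?p x" if "z \<in> orbit ?p x" "z \<in> B" for z
    proof (cases "q z = y")
      case True
      then show ?thesis using px orbit.base[of ?p x] by simp
    next
      case False
      have "q z \<noteq> x" using that q x permutes_in_image by metis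
      then have "?p z = q z" using False by simp
      then show ?thesis using orbit.step[OF that(1)] by simp
    qed
    have yin: "y \<in> orbit ?p x" using px orbit.base[of ?p x] by simp
    from that show ?thesis
    proof induct
      case base
      then show ?case using * yin y by blast
    next
      case (step z)
      then show ?case using * sub by blast
    qed
  qed
  moreover have "x \<in> orbit ?p x" by (rule permutes_self_in_orbit[OF p]) (use B in simp)
  ultimately show ?thesis by blast
qed

text \<open>Only the cycle through \<open>y\<close> feels the insertion: on any other orbit the
  values of \<open>q\<close> avoid both \<open>x\<close> and \<open>y\<close>.\<close>

lemma orbit_transpose_comp:
  assumes q: "q permutes B" and B: "finite B" and x: "x \<notin> B" and y: "y \<in> B" and z: "z \<in> B"
  shows "orbit (transpose x y \<circ> q) z =
    (if y \<in> orbit q z then insert x (orbit q z) else orbit q z)"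
proof (cases "y \<in> orbit q z")
  case True
  let ?p = "transpose x y \<circ> q"
  have p: "?p permutes insert x B"
    by (intro permutes_compose permutes_swap_id permutes_subset[OF q]) (use y in auto)
  have eq: "orbit q y = orbit q z" using permutes_orbit_eq[OF q B True] .
  have "z \<in> orbit ?p x"
    using orbit_transpose_comp_new[OF q B x y] permutes_self_in_orbit[OF q B] eq by blast
  then have "orbit ?p z = orbit ?p x"
    using permutes_orbit_eq[OF p] B by simp
  then show ?thesis using orbit_transpose_comp_new[OF q B x y] eq True by simp
next
  case False
  have sub: "orbit q z \<subseteq> B" using q z by (rule permutes_orbit_subset)
  have "orbit q z = orbit (transpose x y \<circ> q) z"
  proof (rule orbit_cong0[of _ "orbit q z"])
    show "z \<in> orbit q z" by (rule permutes_self_in_orbit[OF q B])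
    show "q \<in> orbit q z \<rightarrow> orbit q z" by (auto intro: orbit.step)
    fix w assume "w \<in> orbit q z"
    then have "q w \<in> orbit q z" by (rule orbit.step)
    then show "q w = (transpose x y \<circ> q) w" using False sub x by (auto simp: transpose_def)
  qed
  then show ?thesis using False by simp
qed

text \<open>
  A permutation of type \<open>\<mu>\<close> together with a base point in each of its cycles, listed so that the
  \<open>i\<close>-th base point lies in a cycle of length \<open>\<mu> ! i\<close>. Unlike permutations of type \<open>\<mu>\<close>, these
  can be counted recursively: deleting the first base point \<open>x\<close> and moving the mark on to \<open>p x\<close>
  lowers the first part by one, and it flips the sign unless \<open>x\<close> was a fixed point.
\<close>

definition marked_perms :: "'a set \<Rightarrow> nat list \<Rightarrow> (('a \<Rightarrow> 'a) \<times> 'a list) set" where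
  "marked_perms A \<mu> = {(p, xs). p permutes A \<and> set xs \<subseteq> A \<and> distinct (map (orbit p) xs) \<and>
     set (map (orbit p) xs) = orbit p ` A \<and> map (\<lambda>x. card (orbit p x)) xs = \<mu>}"

lemma marked_perms_Nil_iff: "(p, xs) \<in> marked_perms A [] \<longleftrightarrow> A = {} \<and> p = id \<and> xs = []"
  by (auto simp: marked_perms_def)

lemma marked_perms_Cons_1_iff:
  assumes "finite A"
  shows "(p, x # xs) \<in> marked_perms A (1 # \<mu>) \<longleftrightarrow> x \<in> A \<and> (p, xs) \<in> marked_perms (A - {x}) \<mu>"
proof
  assume asm: "(p, x # xs) \<in> marked_perms A (1 # \<mu>)"
  then have p: "p permutes A" and x: "x \<in> A" "set xs \<subseteq> A" and dis: "distinct (map (orbit p) (x # xs))"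
    and im: "set (map (orbit p) (x # xs)) = orbit p ` A" and c: "card (orbit p x) = 1"
    "map (\<lambda>x. card (orbit p x)) xs = \<mu>"
    by (auto simp: marked_perms_def)
  have self: "z \<in> orbit p z" for z by (rule permutes_self_in_orbit[OF p assms])
  have ox: "orbit p x = {x}" using c self[of x] by (metis card_1_singletonE singletonD)
  have "p x = x" using ox orbit_eq_singleton_iff[of p x] by blast
  then have "p permutes (A - {x})" using p by (metis Diff_iff permutes_superset singletonD)
  moreover have "set xs \<subseteq> A - {x}" using dis x by auto
  moreover have "orbit p x \<notin> orbit p ` (A - {x})" using self unfolding ox by auto
  then have "set (map (orbit p) xs) = orbit p ` (A - {x})"
    using im dis x by auto
  ultimately show "x \<in> A \<and> (p, xs) \<in> marked_perms (A - {x}) \<mu>"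
    using x dis c by (auto simp: marked_perms_def)
next
  assume asm: "x \<in> A \<and> (p, xs) \<in> marked_perms (A - {x}) \<mu>"
  then have x: "x \<in> A" and p: "p permutes (A - {x})" and xs: "set xs \<subseteq> A - {x}"
    and dis: "distinct (map (orbit p) xs)"
    and im: "orbit p ` set xs = orbit p ` (A - {x})"
    and c: "map (\<lambda>x. card (orbit p x)) xs = \<mu>"
    by (auto simp: marked_perms_def)
  have self: "z \<in> orbit p z" for z by (rule permutes_self_in_orbit[OF p]) (use assms in simp)
  have ox: "orbit p x = {x}" using p by (simp add: orbit_eq_singleton_iff permutes_not_in)
  have "orbit p x \<notin> orbit p ` set xs" using self xs unfolding ox by auto
  moreover have "insert (orbit p x) (orbit p ` set xs) = orbit p ` A" using im x by auto
  moreover have "p permutes A" by (rule permutes_subset[OF p]) auto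
  ultimately show "(p, x # xs) \<in> marked_perms A (1 # \<mu>)"
    using x xs dis c ox by (auto simp: marked_perms_def)
qed

text \<open>On orbits, inserting \<open>x\<close> before \<open>y\<close> is the map that adds
  \<open>x\<close> to the set containing \<open>y\<close>. It is injective because no orbit of
  \<open>q\<close> inside \<open>B\<close> contains \<open>x\<close>, so distinctness and
  completeness of the list of marked cycles carry over in both directions.\<close>

lemma marked_perms_transpose_iff:
  assumes B: "finite B" and x: "x \<notin> B" and y: "y \<in> B" and q: "q permutes B" and xs: "set xs \<subseteq> B"
  shows "(transpose x y \<circ> q, x # xs) \<in> marked_perms (insert x B) (Suc m # \<mu>) \<longleftrightarrow>
    (q, y # xs) \<in> marked_perms B (m # \<mu>)"
proof -
  define p where "p = transpose x y \<circ> q"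
  let ?f = "\<lambda>S. if y \<in> S then insert x S else S"
  have p: "p permutes insert x B" unfolding p_def
    by (intro permutes_compose permutes_swap_id permutes_subset[OF q]) (use y in auto)
  have sub: "orbit q z \<subseteq> B" if "z \<in> B" for z using q that by (rule permutes_orbit_subset)
  have fin: "finite (orbit q z)" if "z \<in> B" for z using sub[OF that] B finite_subset by blast
  have yy: "y \<in> orbit q y" by (rule permutes_self_in_orbit[OF q B])
  have o: "orbit p z = ?f (orbit q z)" if "z \<in> B" for z
    unfolding p_def by (rule orbit_transpose_comp[OF q B x y that])
  have ox: "orbit p x = ?f (orbit q y)"
    using orbit_transpose_comp_new[OF q B x y] yy unfolding p_def by simp
  have inj: "inj_on ?f (orbit q ` B)"
  proof (rule inj_onI)
    fix S S' assume S: "S \<in> orbit q ` B" "S' \<in> orbit q ` B" and eq: "?f S = ?f S'"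
    have "x \<notin> S" "x \<notin> S'" using sub S x by auto
    then show "S = S'" using eq by (auto split: if_splits)
  qed
  have m: "map (orbit p) (x # xs) = map ?f (map (orbit q) (y # xs))"
    using ox o xs by (simp add: subset_iff)
  have im: "orbit p ` insert x B = ?f ` orbit q ` B"
  proof -
    have "orbit p ` insert x B = insert (?f (orbit q y)) (orbit p ` B)" using ox by simp
    also have "orbit p ` B = ?f ` orbit q ` B" using o by (auto simp: image_image intro!: image_cong)
    finally show ?thesis using y by auto
  qed
  have subo: "set (map (orbit q) (y # xs)) \<subseteq> orbit q ` B" using xs y by auto
  have 1: "distinct (map (orbit p) (x # xs)) \<longleftrightarrow> distinct (map (orbit q) (y # xs))"
    unfolding m using inj_on_subset[OF inj subo] distinct_map by blast
  have 2: "set (map (orbit p) (x # xs)) = orbit p ` insert x B \<longleftrightarrow>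
      set (map (orbit q) (y # xs)) = orbit q ` B"
    unfolding m im set_map[of ?f] using inj_on_image_eq_iff[OF inj subo subset_refl] .
  \<comment> \<open>Distinctness keeps the other base points out of the cycle of \<open>y\<close>,
    so only the first cycle grows.\<close>
  have 3: "(map (\<lambda>z. card (orbit p z)) (x # xs) = Suc m # \<mu>) \<longleftrightarrow>
      (map (\<lambda>z. card (orbit q z)) (y # xs) = m # \<mu>)" if "distinct (map (orbit q) (y # xs))"
  proof -
    have "card (orbit p x) = Suc (card (orbit q y))"
    proof -
      have "x \<notin> orbit q y" using sub[OF y] x by blast
      then show ?thesis using ox yy fin[OF y] by simp
    qed
    moreover have "card (orbit p z) = card (orbit q z)" if "z \<in> set xs" for z
    proof -
      have "orbit q z \<noteq> orbit q y" using that \<open>distinct _\<close> by auto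
      then have "y \<notin> orbit q z" using permutes_orbit_eq[OF q B] by blast
      then show ?thesis using o[of z] that xs by auto
    qed
    ultimately show ?thesis by (simp cong: map_cong)
  qed
  show ?thesis
    unfolding p_def[symmetric] marked_perms_def mem_Collect_eq case_prod_conv 1 2
    using 3 p q xs y by auto
qed

text \<open>Removing a fixed point lowers both the number of points and the number of cycles, which
  preserves the parity of their sum; removing a point of a longer cycle lowers only the former and
  costs one transposition. Modulo 2 the exponent is the usual number of points minus number of
  cycles.\<close>

lemma marked_perms_sign:
  assumes "finite A" "(p, xs) \<in> marked_perms A \<mu>"
  shows "sign p = (-1) ^ (card A + length \<mu>)"
  using assms
proof (induction "card A" arbitrary: A p xs \<mu>)
  case 0
  then show ?case by (auto simp: marked_perms_def)
next
  case (Suc N)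
  from Suc.hyps have "A \<noteq> {}" by auto
  then obtain x xs' where xs: "xs = x # xs'" using Suc.prems
    by (cases xs) (auto simp: marked_perms_def)
  obtain m \<mu>' where mu: "\<mu> = m # \<mu>'" using Suc.prems xs by (auto simp: marked_perms_def)
  have p: "p permutes A" and x: "x \<in> A" and xs': "set xs' \<subseteq> A" and m: "card (orbit p x) = m"
    and dis: "distinct (map (orbit p) xs)"
    using Suc.prems xs mu by (auto simp: marked_perms_def)
  have self: "z \<in> orbit p z" for z by (rule permutes_self_in_orbit[OF p Suc.prems(1)])
  have cA: "card (A - {x}) = N" using Suc x by simp
  show ?case
  proof (cases "p x = x")
    case True
    then have "orbit p x = {x}" by (simp add: orbit_eq_singleton_iff)
    then have "m = 1" using m by simp
    then have "(p, xs') \<in> marked_perms (A - {x}) \<mu>'"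
      using Suc.prems marked_perms_Cons_1_iff[OF Suc.prems(1)] xs mu by blast
    from Suc.hyps(1)[OF _ _ this] have "sign p = (-1) ^ (N + length \<mu>')"
      using cA Suc.prems by auto
    then show ?thesis using mu Suc.hyps(2)[symmetric] by simp
  next
    case False
    define y q where "y = p x" and "q = transpose x y \<circ> p"
    have pq: "p = transpose x y \<circ> q" by (simp add: q_def fun_eq_iff)
    have yA: "y \<in> A - {x}" using False p x permutes_in_image y_def by fastforce
    have q: "q permutes (A - {x})"
      unfolding q_def y_def by (rule permutes_transpose_image_comp[OF p x])
    have xs'x: "set xs' \<subseteq> A - {x}" using xs' dis xs by auto
    have "m > 0" using m self[of x] Suc.prems(1) permutes_orbit_subset[OF p x]
      by (metis card_gt_0_iff empty_iff finite_subset)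
    then obtain m' where m': "m = Suc m'" by (cases m) auto
    have "(q, y # xs') \<in> marked_perms (A - {x}) (m' # \<mu>')"
      using marked_perms_transpose_iff[of "A - {x}" x y q xs' m' \<mu>'] Suc.prems q yA xs'x
      unfolding pq[symmetric] xs mu m' using x by (auto simp: insert_absorb)
    from Suc.hyps(1)[OF _ _ this] have "sign q = (-1) ^ (N + length \<mu>)"
      using cA Suc.prems mu by auto
    moreover have "sign p = - sign q"
    proof -
      have "permutation q" using q Suc.prems(1) permutes_imp_permutation by blast
      then have "sign p = sign (transpose x y) * sign q"
        unfolding pq by (intro sign_compose permutation_swap_id)
      then show ?thesis using yA by (auto simp: sign_swap_id)
    qed
    ultimately show ?thesis using Suc.hyps(2)[symmetric] by simp
  qed
qed

section \<open>The number of marked permutations\<close>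

lemma finite_marked_perms:
  assumes "finite A" shows "finite (marked_perms A \<mu>)"
proof (rule finite_subset)
  show "marked_perms A \<mu> \<subseteq> {p. p permutes A} \<times> {xs. set xs \<subseteq> A \<and> length xs = length \<mu>}"
    by (auto simp: marked_perms_def)
  show "finite ({p. p permutes A} \<times> {xs. set xs \<subseteq> A \<and> length xs = length \<mu>})"
    using assms by (intro finite_cartesian_product finite_permutations finite_lists_length_eq)
qed

lemma card_marked_perms_Cons_1:
  assumes "finite A"
  shows "card (marked_perms A (1 # \<mu>)) = (\<Sum>x\<in>A. card (marked_perms (A - {x}) \<mu>))"
proof -
  have "bij_betw (\<lambda>(x, p, xs). (p, x # xs)) (SIGMA x:A. marked_perms (A - {x}) \<mu>)
      (marked_perms A (1 # \<mu>))"
    unfolding bij_betw_def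
  proof
    show "inj_on (\<lambda>(x, p, xs). (p, x # xs)) (SIGMA x:A. marked_perms (A - {x}) \<mu>)"
      by (auto simp: inj_on_def)
    show "(\<lambda>(x, p, xs). (p, x # xs)) ` (SIGMA x:A. marked_perms (A - {x}) \<mu>) = marked_perms A (1 # \<mu>)"
    proof (intro equalityI subsetI)
      fix w assume "w \<in> marked_perms A (1 # \<mu>)"
      moreover then obtain p x xs where "w = (p, x # xs)" by (auto simp: marked_perms_def)
      ultimately show "w \<in> (\<lambda>(x, p, xs). (p, x # xs)) ` (SIGMA x:A. marked_perms (A - {x}) \<mu>)"
        using marked_perms_Cons_1_iff[OF assms, of p x xs \<mu>]
        by (auto intro!: image_eqI[of _ _ "(x, p, xs)"])
    qed (use marked_perms_Cons_1_iff[OF assms] in auto)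
  qed
  from bij_betw_same_card[OF this] show ?thesis
    using assms by (simp add: card_SigmaI finite_marked_perms)
qed

text \<open>The bijection inserts a new point \<open>x\<close> just before the marked point
  \<open>hd ys\<close> and moves the mark to \<open>x\<close>. Conversely, removing a point from a
  cycle of length at least 2 leaves a point to carry the mark.\<close>

lemma card_marked_perms_Cons_Suc_Suc:
  assumes "finite A"
  shows "card (marked_perms A (Suc (Suc m) # \<mu>)) = (\<Sum>x\<in>A. card (marked_perms (A - {x}) (Suc m # \<mu>)))"
proof -
  let ?f = "\<lambda>(x, q, ys). (transpose x (hd ys) \<circ> q, x # tl ys)"
  let ?S = "SIGMA x:A. marked_perms (A - {x}) (Suc m # \<mu>)"
  have dest: "\<exists>y xs. ys = y # xs \<and> y \<in> A - {x} \<and> set xs \<subseteq> A - {x} \<and> q permutes (A - {x}) \<and> q x = x"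
    if "(q, ys) \<in> marked_perms (A - {x}) (Suc m # \<mu>)" for x q ys
    using that by (cases ys) (auto simp: marked_perms_def permutes_not_in)
  have "bij_betw ?f ?S (marked_perms A (Suc (Suc m) # \<mu>))"
    unfolding bij_betw_def
  proof
    show "inj_on ?f ?S"
    proof (rule inj_onI)
      fix u v assume u: "u \<in> ?S" and v: "v \<in> ?S" and eq: "?f u = ?f v"
      obtain x q ys where u': "u = (x, q, ys)" by (cases u) auto
      obtain x' q' ys' where v': "v = (x', q', ys')" by (cases v) auto
      from dest[of q ys x] u u' obtain y xs where ys: "ys = y # xs" "q x = x" by auto
      from dest[of q' ys' x'] v v' obtain y' xs' where ys': "ys' = y' # xs'" "q' x' = x'" by auto
      have e: "x = x'" "xs = xs'" "transpose x y \<circ> q = transpose x y' \<circ> q'"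
        using eq u' v' ys ys' by auto
      \<comment> \<open>Both \<open>q\<close> and \<open>q'\<close> fix \<open>x\<close>, so
        evaluation at \<open>x\<close> recovers the point before which \<open>x\<close> was
        inserted.\<close>
      have yy: "y = y'" using fun_cong[OF e(3), of x] ys(2) ys'(2) e(1) by simp
      have "q = transpose x y \<circ> (transpose x y \<circ> q)" by (simp add: fun_eq_iff)
      also have "\<dots> = transpose x y \<circ> (transpose x y \<circ> q')" unfolding e(3) unfolding yy ..
      also have "\<dots> = q'" by (simp add: fun_eq_iff)
      finally show "u = v" using e yy u' v' ys ys' by simp
    qed
    show "?f ` ?S = marked_perms A (Suc (Suc m) # \<mu>)"
    proof (intro equalityI subsetI)
      fix w assume "w \<in> ?f ` ?S"
      then obtain x q ys where w: "w = ?f (x, q, ys)" and x: "x \<in> A"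
        and q: "(q, ys) \<in> marked_perms (A - {x}) (Suc m # \<mu>)" by auto
      from dest[OF q] obtain y xs where ys: "ys = y # xs" "y \<in> A - {x}" "set xs \<subseteq> A - {x}"
        "q permutes (A - {x})" by auto
      then have "(transpose x y \<circ> q, x # xs) \<in> marked_perms (insert x (A - {x})) (Suc (Suc m) # \<mu>)"
        using q assms by (subst marked_perms_transpose_iff) auto
      then show "w \<in> marked_perms A (Suc (Suc m) # \<mu>)" using w ys x by (simp add: insert_absorb)
    next
      fix w assume w: "w \<in> marked_perms A (Suc (Suc m) # \<mu>)"
      then obtain p x xs where wp: "w = (p, x # xs)" by (auto simp: marked_perms_def)
      have p: "p permutes A" and x: "x \<in> A" and xs: "set xs \<subseteq> A" and c: "card (orbit p x) = Suc (Suc m)"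
        and dis: "distinct (map (orbit p) (x # xs))"
        using w wp by (auto simp: marked_perms_def)
      define y q where "y = p x" and "q = transpose x y \<circ> p"
      have "p x \<noteq> x"
      proof
        assume "p x = x"
        then have "orbit p x = {x}" by (simp add: orbit_eq_singleton_iff)
        then show False using c by simp
      qed
      have pq: "p = transpose x y \<circ> q" by (simp add: q_def fun_eq_iff)
      have yA: "y \<in> A - {x}" using \<open>p x \<noteq> x\<close> p x permutes_in_image y_def by fastforce
      have q: "q permutes (A - {x})"
        unfolding q_def y_def by (rule permutes_transpose_image_comp[OF p x])
      have xsx: "set xs \<subseteq> A - {x}" using xs dis by auto
      have "(q, y # xs) \<in> marked_perms (A - {x}) (Suc m # \<mu>)"
        using marked_perms_transpose_iff[of "A - {x}" x y q xs "Suc m" \<mu>] assms w wp q yA xsx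
        unfolding pq[symmetric] using x by (auto simp: insert_absorb)
      then show "w \<in> ?f ` ?S" using wp pq x by (auto intro!: image_eqI[of _ _ "(x, q, y # xs)"])
    qed
  qed
  from bij_betw_same_card[OF this] show ?thesis
    using assms by (simp add: card_SigmaI finite_marked_perms)
qed

text \<open>At each stage the first base point can be any of the \<open>card A\<close> points,
  whatever the parts are, so the product of these factors is a factorial independent of
  \<open>\<mu>\<close>.\<close>

lemma card_marked_perms:
  assumes "finite A" "sum_list \<mu> = card A" "0 \<notin> set \<mu>"
  shows "card (marked_perms A \<mu>) = fact (card A)"
  using assms
proof (induction "card A" arbitrary: A \<mu>)
  case 0
  then have "\<mu> = []" "A = {}" by (cases \<mu>; auto)+
  then have "marked_perms A \<mu> = {(id, [])}" using marked_perms_Nil_iff[of _ _ A] by auto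
  then show ?case using \<open>A = {}\<close> by simp
next
  case (Suc N)
  obtain m \<mu>' where mu: "\<mu> = Suc m # \<mu>'"
    using Suc.hyps(2) Suc.prems by (cases \<mu>; cases "hd \<mu>") auto
  \<comment> \<open>A first part 1 disappears when its point is removed; a larger one stays and
    drops by one.\<close>
  have "card (marked_perms A \<mu>) =
      (\<Sum>x\<in>A. card (marked_perms (A - {x}) (if m = 0 then \<mu>' else m # \<mu>')))"
    using card_marked_perms_Cons_1[OF Suc.prems(1), of \<mu>']
      card_marked_perms_Cons_Suc_Suc[OF Suc.prems(1), of "m - 1" \<mu>'] mu by auto
  also have "\<dots> = (\<Sum>x\<in>A. fact N)"
  proof (rule sum.cong)
    fix x assume "x \<in> A"
    then have c: "card (A - {x}) = N" using Suc by simp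
    show "card (marked_perms (A - {x}) (if m = 0 then \<mu>' else m # \<mu>')) = fact N"
      using Suc.hyps(1)[of "A - {x}" "if m = 0 then \<mu>' else m # \<mu>'"] c Suc.hyps(2) Suc.prems mu
      by auto
  qed simp
  finally show ?case using Suc.hyps(2)[symmetric] by simp
qed

section \<open>Permutations of given cycle type\<close>

lemma in_listset_iff: "xs \<in> listset As \<longleftrightarrow> list_all2 (\<in>) xs As"
  by (induction As arbitrary: xs) (auto simp: set_Cons_def list_all2_Cons2)

lemma listset_Cons_conv: "listset (A # As) = (\<lambda>(x, xs). x # xs) ` (A \<times> listset As)"
  by (auto simp: set_Cons_def)

lemma card_listset: "card (listset As) = prod_list (map card As)"
proof (induction As)
  case (Cons A As)
  have "inj_on (\<lambda>(x, xs). x # xs) (A \<times> listset As)" by (auto simp: inj_on_def)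
  from card_image[OF this] show ?case
    using Cons.IH unfolding listset_Cons_conv by (simp add: card_cartesian_product)
qed simp

lemma finite_listset: "\<forall>A\<in>set As. finite A \<Longrightarrow> finite (listset As)"
proof (induction As)
  case (Cons A As)
  then show ?case unfolding listset_Cons_conv by (intro finite_imageI finite_cartesian_product) auto
qed simp

text \<open>Any two such enumerations differ by a unique permutation of the positions, and this
  permutation has to fix \<open>\<mu>\<close>. So the enumerations form a free orbit of
  \<open>tuple_Aut \<mu>\<close>, once a single one has been found.\<close>

lemma card_enumerations_with_image:
  assumes F: "finite F" and im: "image_mset f (mset_set F) = mset \<mu>"
  shows "card {xs. distinct xs \<and> set xs = F \<and> map f xs = \<mu>} = card (tuple_Aut \<mu>)"
proof -
  obtain l where l: "set l = F" "distinct l" using finite_distinct_list[OF F] by blast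
  have "mset (map f l) = mset \<mu>" using im l mset_set_set[of l] by simp
  then obtain \<rho> where rho: "\<rho> permutes {..<length (map f l)}" "permute_list \<rho> (map f l) = \<mu>"
    by (metis mset_eq_permutation)
  define zs where "zs = permute_list \<rho> l"
  have zs: "set zs = F" "distinct zs" "map f zs = \<mu>"
    using l rho by (auto simp: zs_def permute_list_map)
  have len: "length zs = length \<mu>" using zs(3) by auto
  have "bij_betw (\<lambda>\<sigma>. permute_list \<sigma> zs) (tuple_Aut \<mu>) {xs. distinct xs \<and> set xs = F \<and> map f xs = \<mu>}"
    unfolding bij_betw_def
  proof
    show "inj_on (\<lambda>\<sigma>. permute_list \<sigma> zs) (tuple_Aut \<mu>)"
    proof (rule inj_onI)
      fix \<sigma> \<tau> assume s: "\<sigma> \<in> tuple_Aut \<mu>" "\<tau> \<in> tuple_Aut \<mu>"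
        and eq: "permute_list \<sigma> zs = permute_list \<tau> zs"
      have p: "\<sigma> permutes {..<length zs}" "\<tau> permutes {..<length zs}"
        using s by (auto simp: tuple_Aut_def len)
      have "\<sigma> i = \<tau> i" for i
      proof (cases "i < length zs")
        case True
        then have "zs ! \<sigma> i = zs ! \<tau> i" using eq p by (metis permute_list_nth)
        moreover have "\<sigma> i < length zs" "\<tau> i < length zs"
          using True permutes_in_image[OF p(1), of i] permutes_in_image[OF p(2), of i] by auto
        ultimately show ?thesis using zs(2) by (simp add: nth_eq_iff_index_eq)
      next
        case False
        then show ?thesis using p by (simp add: permutes_not_in)
      qed
      then show "\<sigma> = \<tau>" by blast
    qed
    show "(\<lambda>\<sigma>. permute_list \<sigma> zs) ` tuple_Aut \<mu> = {xs. distinct xs \<and> set xs = F \<and> map f xs = \<mu>}"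
    proof (intro equalityI subsetI)
      fix xs assume "xs \<in> (\<lambda>\<sigma>. permute_list \<sigma> zs) ` tuple_Aut \<mu>"
      then obtain \<sigma> where s: "\<sigma> permutes {..<length zs}" "\<forall>i<length \<mu>. \<mu> ! \<sigma> i = \<mu> ! i"
        "xs = permute_list \<sigma> zs" by (auto simp: tuple_Aut_def len)
      have "map f xs = permute_list \<sigma> \<mu>" using s zs(3) by (metis permute_list_map)
      also have "\<dots> = \<mu>" using s by (intro nth_equalityI) (auto simp: permute_list_nth len)
      finally show "xs \<in> {xs. distinct xs \<and> set xs = F \<and> map f xs = \<mu>}" using s zs by simp
    next
      fix xs assume "xs \<in> {xs. distinct xs \<and> set xs = F \<and> map f xs = \<mu>}"
      then have xs: "distinct xs" "set xs = F" "map f xs = \<mu>" by auto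
      then have "mset xs = mset zs" using zs set_eq_iff_mset_eq_distinct by blast
      then obtain \<sigma> where s: "\<sigma> permutes {..<length zs}" "permute_list \<sigma> zs = xs"
        by (metis mset_eq_permutation)
      have "permute_list \<sigma> \<mu> = \<mu>" using s zs(3) xs(3) by (metis permute_list_map)
      then have "\<forall>i<length \<mu>. \<mu> ! \<sigma> i = \<mu> ! i" using s(1) len by (metis permute_list_nth)
      then have "\<sigma> \<in> tuple_Aut \<mu>" using s(1) len by (simp add: tuple_Aut_def)
      then show "xs \<in> (\<lambda>\<sigma>. permute_list \<sigma> zs) ` tuple_Aut \<mu>" using s(2) by blast
    qed
  qed
  then show ?thesis by (simp add: bij_betw_same_card)
qed

text \<open>
  A marking amounts to an ordering of the cycles compatible with \<open>\<mu>\<close>, which gives the factor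
  \<open>Aut(\<mu>)\<close>, followed by the choice of a point in each cycle.
\<close>

lemma card_markings:
  assumes p: "p permutes A" and A: "finite A"
    and im: "image_mset card (mset_set (orbit p ` A)) = mset \<mu>"
  shows "card {xs. (p, xs) \<in> marked_perms A \<mu>} = card (tuple_Aut \<mu>) * prod_list \<mu>"
proof -
  define E where "E = {Os. distinct Os \<and> set Os = orbit p ` A \<and> map card Os = \<mu>}"
  have sub: "orbit p z \<subseteq> A" if "z \<in> A" for z using p that by (rule permutes_orbit_subset)
  have finE: "finite E"
  proof (rule finite_subset)
    show "E \<subseteq> {Os. set Os \<subseteq> orbit p ` A \<and> length Os = length \<mu>}" by (auto simp: E_def)
    show "finite {Os. set Os \<subseteq> orbit p ` A \<and> length Os = length \<mu>}"
      using A by (intro finite_lists_length_eq) simp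
  qed
  \<comment> \<open>A point determines its cycle, so the list of chosen points determines
    \<open>Os\<close>. This makes the union below disjoint.\<close>
  have map_orbit: "map (orbit p) xs = Os" if "Os \<in> E" "xs \<in> listset Os" for Os xs
  proof (rule nth_equalityI)
    have la: "list_all2 (\<in>) xs Os" using that in_listset_iff by blast
    then show "length (map (orbit p) xs) = length Os" using list_all2_lengthD by auto
    fix i assume i: "i < length (map (orbit p) xs)"
    then have "xs ! i \<in> Os ! i" using la list_all2_nthD by force
    moreover obtain z where "Os ! i = orbit p z"
    proof -
      have "Os ! i \<in> set Os" using i la list_all2_lengthD by force
      then show ?thesis using that \<open>Os \<in> E\<close> by (auto simp: E_def)
    qed
    ultimately show "map (orbit p) xs ! i = Os ! i"
      using i permutes_orbit_eq[OF p A] by auto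
  qed
  have "{xs. (p, xs) \<in> marked_perms A \<mu>} = (\<Union>Os\<in>E. listset Os)"
  proof (intro equalityI subsetI)
    fix xs assume "xs \<in> {xs. (p, xs) \<in> marked_perms A \<mu>}"
    then have "map (orbit p) xs \<in> E" by (auto simp: marked_perms_def E_def comp_def)
    moreover have "xs \<in> listset (map (orbit p) xs)"
      using permutes_self_in_orbit[OF p A] by (simp add: in_listset_iff list_all2_conv_all_nth)
    ultimately show "xs \<in> (\<Union>Os\<in>E. listset Os)" by blast
  next
    fix xs assume "xs \<in> (\<Union>Os\<in>E. listset Os)"
    then obtain Os where Os: "Os \<in> E" "xs \<in> listset Os" by blast
    have m: "map (orbit p) xs = Os" by (rule map_orbit[OF Os])
    have "x \<in> A" if "x \<in> set xs" for x
    proof -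
      have "orbit p x \<in> set Os" using that unfolding m[symmetric] by simp
      moreover have "set Os = orbit p ` A" using Os(1) by (simp add: E_def)
      ultimately have "orbit p x \<in> orbit p ` A" by simp
      then obtain z where "z \<in> A" "orbit p x = orbit p z" by (rule imageE)
      then show ?thesis using sub[of z] permutes_self_in_orbit[OF p A, of x] by auto
    qed
    moreover have "map (\<lambda>x. card (orbit p x)) xs = map card Os" using m by auto
    ultimately show "xs \<in> {xs. (p, xs) \<in> marked_perms A \<mu>}"
      using Os(1) p m unfolding marked_perms_def E_def by (simp add: subset_iff flip: set_map)
  qed
  moreover have "card (\<Union>Os\<in>E. listset Os) = (\<Sum>Os\<in>E. card (listset Os))"
  proof (rule card_UN_disjoint[OF finE])
    show "\<forall>Os\<in>E. finite (listset Os)"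
    proof
      fix Os assume "Os \<in> E"
      then show "finite (listset Os)" using sub A
        by (intro finite_listset) (auto simp: E_def intro: finite_subset)
    qed
    show "\<forall>Os\<in>E. \<forall>Os'\<in>E. Os \<noteq> Os' \<longrightarrow> listset Os \<inter> listset Os' = {}"
      using map_orbit by blast
  qed
  moreover have "\<dots> = (\<Sum>Os\<in>E. prod_list \<mu>)"
    by (rule sum.cong) (auto simp: card_listset E_def)
  moreover have "card E = card (tuple_Aut \<mu>)"
    unfolding E_def using A im by (intro card_enumerations_with_image) auto
  ultimately show ?thesis by simp
qed

section \<open>Size and sign of a class of permutations\<close>

definition perms_of_type :: "nat \<Rightarrow> nat multiset \<Rightarrow> (nat \<Rightarrow> nat) set" where
  "perms_of_type d M = {p. p permutes {1..d} \<and> cycle_type d p = M}"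

lemma marked_perms_eq_Sigma:
  "marked_perms {1..d} \<mu> = (SIGMA p:perms_of_type d (mset \<mu>). {xs. (p, xs) \<in> marked_perms {1..d} \<mu>})"
proof -
  have "p \<in> perms_of_type d (mset \<mu>)" if "(p, xs) \<in> marked_perms {1..d} \<mu>" for p xs
  proof -
    have p: "p permutes {1..d}" and dis: "distinct (map (orbit p) xs)"
      and im: "set (map (orbit p) xs) = orbit p ` {1..d}"
      and mu: "map (\<lambda>x. card (orbit p x)) xs = \<mu>"
      using that by (auto simp: marked_perms_def)
    have "cycle_type d p = image_mset card (mset (map (orbit p) xs))"
      unfolding cycle_type_def im[symmetric] by (simp only: mset_set_set[OF dis])
    also have "\<dots> = mset \<mu>" using mu by (auto simp: multiset.map_comp comp_def)
    finally show ?thesis using p by (simp add: perms_of_type_def)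
  qed
  then show ?thesis by auto
qed

lemma finite_perms_of_type: "finite (perms_of_type d M)"
  by (rule finite_subset[OF _ finite_permutations[of "{1..d}"]]) (auto simp: perms_of_type_def)

lemma tuple_Aut_pos: "card (tuple_Aut \<mu>) > 0"
proof -
  have "finite (tuple_Aut \<mu>)"
    by (rule finite_subset[OF _ finite_permutations[of "{..<length \<mu>}"]]) (auto simp: tuple_Aut_def)
  moreover have "id \<in> tuple_Aut \<mu>" by (auto simp: tuple_Aut_def permutes_id)
  ultimately show ?thesis by (auto simp: card_gt_0_iff)
qed

text \<open>Double counting of marked permutations: there are d! in all, and equally many over each
  permutation of the type.\<close>

lemma card_perms_of_type:
  assumes "0 \<notin> set \<mu>" "sum_list \<mu> = d"
  shows "card (perms_of_type d (mset \<mu>)) * (card (tuple_Aut \<mu>) * prod_list \<mu>) = fact d"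
proof -
  have mk: "card {xs. (p, xs) \<in> marked_perms {1..d} \<mu>} = card (tuple_Aut \<mu>) * prod_list \<mu>"
    if "p \<in> perms_of_type d (mset \<mu>)" for p
    using that by (intro card_markings) (auto simp: perms_of_type_def cycle_type_def)
  have fin: "finite {xs. (p, xs) \<in> marked_perms {1..d} \<mu>}" for p
    by (rule finite_subset[OF _ finite_imageI[OF finite_marked_perms[of "{1..d}" \<mu>], of snd]]) force+
  have "fact d = card (marked_perms {1..d} \<mu>)"
    using card_marked_perms[of "{1..d}" \<mu>] assms by simp
  also have "\<dots> = (\<Sum>p\<in>perms_of_type d (mset \<mu>). card {xs. (p, xs) \<in> marked_perms {1..d} \<mu>})"
    by (subst marked_perms_eq_Sigma) (use fin finite_perms_of_type in \<open>auto intro!: card_SigmaI\<close>)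
  also have "\<dots> = (\<Sum>p\<in>perms_of_type d (mset \<mu>). card (tuple_Aut \<mu>) * prod_list \<mu>)"
    using mk by simp
  finally show ?thesis by simp
qed

text \<open>The sign is known in the presence of a marking, and a marking exists because the number
  of markings is not zero.\<close>

lemma sign_perms_of_type:
  assumes "0 \<notin> set \<mu>" "p \<in> perms_of_type d (mset \<mu>)"
  shows "sign p = (-1) ^ (d + length \<mu>)"
proof -
  have "card {xs. (p, xs) \<in> marked_perms {1..d} \<mu>} = card (tuple_Aut \<mu>) * prod_list \<mu>"
    using assms by (intro card_markings) (auto simp: perms_of_type_def cycle_type_def)
  moreover have "prod_list \<mu> \<noteq> 0" using assms(1) by (simp add: prod_list_zero_iff)
  ultimately have "card {xs. (p, xs) \<in> marked_perms {1..d} \<mu>} \<noteq> 0"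
    using tuple_Aut_pos[of \<mu>] by simp
  then obtain xs where "(p, xs) \<in> marked_perms {1..d} \<mu>" by (metis card.empty empty_Collect_eq)
  from marked_perms_sign[OF _ this] show ?thesis by simp
qed

section \<open>Equidistribution of products of transpositions\<close>

definition transposition_words :: "nat \<Rightarrow> nat \<Rightarrow> (nat \<Rightarrow> nat) list set" where
  "transposition_words d k = {ts. set ts \<subseteq> transpositions d \<and> length ts = k}"

text \<open>A transposition is determined by the pair of points that it moves.\<close>

lemma card_transpositions: "card (transpositions d) = d choose 2"
proof -
  have "bij_betw (\<lambda>t. {x. t x \<noteq> x}) (transpositions d) {K. K \<subseteq> {1..d} \<and> card K = 2}"
    unfolding bij_betw_def
  proof
    have supp: "{x. transpose a b x \<noteq> x} = {a, b}" if "a \<noteq> b" for a b :: nat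
      using that by (auto simp: transpose_def)
    show "inj_on (\<lambda>t. {x. t x \<noteq> x}) (transpositions d)"
      by (rule inj_onI) (auto simp: transpositions_def supp doubleton_eq_iff transpose_commute)
    show "(\<lambda>t. {x. t x \<noteq> x}) ` transpositions d = {K. K \<subseteq> {1..d} \<and> card K = 2}"
    proof (intro equalityI subsetI)
      fix K assume "K \<in> {K. K \<subseteq> {1..d} \<and> card K = 2}"
      then obtain a b where ab: "K = {a, b}" "a \<noteq> b" "a \<in> {1..d}" "b \<in> {1..d}"
        by (auto simp: card_2_iff)
      then have "transpose a b \<in> transpositions d" by (auto simp: transpositions_def)
      then show "K \<in> (\<lambda>t. {x. t x \<noteq> x}) ` transpositions d" using supp[OF ab(2)] ab(1) by blast
    next
      fix K assume "K \<in> (\<lambda>t. {x. t x \<noteq> x}) ` transpositions d"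
      then obtain a b where ab: "K = {x. transpose a b x \<noteq> x}" "a \<noteq> b" "a \<in> {1..d}" "b \<in> {1..d}"
        unfolding transpositions_def by blast
      then show "K \<in> {K. K \<subseteq> {1..d} \<and> card K = 2}" unfolding supp[OF ab(2)] by auto
    qed
  qed
  then have "card (transpositions d) = card {K. K \<subseteq> {1..d} \<and> card K = 2}"
    by (rule bij_betw_same_card)
  then show ?thesis by (simp add: n_subsets)
qed

lemma finite_transpositions: "finite (transpositions d)"
proof (rule finite_subset)
  show "transpositions d \<subseteq> (\<lambda>(a, b). transpose a b) ` ({1..d} \<times> {1..d})"
    by (auto simp: transpositions_def)
qed auto

lemma transpositions_permutes: "t \<in> transpositions d \<Longrightarrow> t permutes {1..d}"
  by (auto simp: transpositions_def intro!: permutes_swap_id)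

lemma sign_transpositions: "t \<in> transpositions d \<Longrightarrow> sign t = -1"
  by (auto simp: transpositions_def sign_swap_id)

lemma transpositions_involution: "t \<in> transpositions d \<Longrightarrow> t \<circ> t = id"
  by (auto simp: transpositions_def)

lemma finite_transposition_words: "finite (transposition_words d k)"
  unfolding transposition_words_def by (intro finite_lists_length_eq finite_transpositions)

lemma card_transposition_words: "card (transposition_words d k) = (d choose 2) ^ k"
  unfolding transposition_words_def
  by (simp add: card_lists_length_eq[OF finite_transpositions] card_transpositions)

lemma foldr_comp_append: "foldr (\<circ>) (us @ vs) id = foldr (\<circ>) us id \<circ> foldr (\<circ>) vs id"
  by (induction us) (simp_all add: o_assoc)

lemma word_permutes: "set ts \<subseteq> transpositions d \<Longrightarrow> foldr (\<circ>) ts id permutes {1..d}"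
proof (induction ts)
  case (Cons t ts)
  have "t permutes {1..d}" by (rule transpositions_permutes) (use Cons.prems in simp)
  moreover have "foldr (\<circ>) ts id permutes {1..d}" by (rule Cons.IH) (use Cons.prems in simp)
  ultimately have "t \<circ> foldr (\<circ>) ts id permutes {1..d}" using permutes_compose by blast
  then show ?case unfolding foldr_Cons o_apply[of "(\<circ>) t"] .
qed (simp add: permutes_id)

lemma sign_word: "set ts \<subseteq> transpositions d \<Longrightarrow> sign (foldr (\<circ>) ts id) = (-1) ^ length ts"
proof (induction ts)
  case (Cons t ts)
  have "permutation t" "permutation (foldr (\<circ>) ts id)"
    using Cons.prems transpositions_permutes word_permutes
    by (auto intro!: permutes_imp_permutation[of "{1..d}"])
  then have "sign (t \<circ> foldr (\<circ>) ts id) = sign t * sign (foldr (\<circ>) ts id)" by (rule sign_compose)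
  moreover have "sign t = -1" by (rule sign_transpositions[of t d]) (use Cons.prems in simp)
  moreover have "sign (foldr (\<circ>) ts id) = (-1) ^ length ts" by (rule Cons.IH) (use Cons.prems in simp)
  ultimately have "sign (t \<circ> foldr (\<circ>) ts id) = (-1) ^ length (t # ts)" by (simp only: length_Cons power_Suc)
  then show ?case unfolding foldr_Cons o_apply[of "(\<circ>) t"] .
qed simp

lemma exists_word:
  assumes "r permutes {1..d}"
  shows "\<exists>ts. set ts \<subseteq> transpositions d \<and> foldr (\<circ>) ts id = r"
  using assms finite_atLeastAtMost[of 1 d]
proof (induction rule: permutes_induct)
  case id
  show ?case by (intro exI[of _ "[]"]) simp
next
  case (swap a b p)
  then obtain ts where ts: "set ts \<subseteq> transpositions d" "foldr (\<circ>) ts id = p" by blast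
  have "transpose a b \<in> transpositions d" using swap.hyps by (auto simp: transpositions_def)
  moreover have "foldr (\<circ>) (transpose a b # ts) id = transpose a b \<circ> p"
    by (simp only: foldr_Cons o_apply ts(2))
  ultimately show ?case using ts(1) by (metis insert_subset list.simps(15))
qed

lemma foldr_comp_replicate_even:
  assumes "t \<circ> t = id" shows "foldr (\<circ>) (replicate (2 * j) t) id = id"
proof (induction j)
  case (Suc j)
  have "foldr (\<circ>) (replicate (2 * Suc j) t) id = (t \<circ> t) \<circ> foldr (\<circ>) (replicate (2 * j) t) id"
    by (simp add: fun_eq_iff)
  then show ?case by (simp only: assms Suc.IH id_o)
qed simp

text \<open>With one length for all even permutations, a single block of \<open>L\<close> steps can
  lead from any permutation to any other of the same sign.\<close>

lemma exists_uniform_word_length: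
  assumes d: "d \<ge> 2"
  obtains L where "L > 0" "even L"
    "\<And>r. r permutes {1..d} \<Longrightarrow> sign r = 1 \<Longrightarrow> \<exists>ts\<in>transposition_words d L. foldr (\<circ>) ts id = r"
proof -
  define E where "E = {r. r permutes {1..d} \<and> sign r = 1}"
  have finE: "finite E"
    by (rule finite_subset[OF _ finite_permutations[of "{1..d}"]]) (auto simp: E_def)
  have "\<forall>r\<in>E. \<exists>ts. set ts \<subseteq> transpositions d \<and> foldr (\<circ>) ts id = r"
    using exists_word by (auto simp: E_def)
  then obtain w where w: "\<And>r. r \<in> E \<Longrightarrow> set (w r) \<subseteq> transpositions d"
    "\<And>r. r \<in> E \<Longrightarrow> foldr (\<circ>) (w r) id = r"
    by metis
  have ev: "even (length (w r))" if "r \<in> E" for r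
  proof -
    have "(-1 :: int) ^ length (w r) = 1" using sign_word[OF w(1)[OF that]] w(2)[OF that] that
      by (simp add: E_def)
    then show ?thesis by (cases "even (length (w r))") auto
  qed
  \<comment> \<open>The sum bounds every chosen length and is even like each of them; the summand 2
    keeps \<open>L\<close> positive even if all chosen words are empty, since \<open>k div L\<close>
    will have to grow.\<close>
  define L where "L = 2 + (\<Sum>r\<in>E. length (w r))"
  have evL: "even L" unfolding L_def using ev by (auto intro!: dvd_sum)
  define t :: "nat \<Rightarrow> nat" where "t = transpose 1 2"
  have t: "t \<in> transpositions d" using d unfolding t_def transpositions_def by force
  show thesis
  proof
    show "L > 0" by (simp add: L_def)
    show "even L" by fact
    fix r assume "r permutes {1..d}" "sign r = 1"
    then have r: "r \<in> E" by (simp add: E_def)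
    have "length (w r) \<le> (\<Sum>r\<in>E. length (w r))" using r finE by (intro member_le_sum) auto
    then have le: "length (w r) \<le> L" by (simp add: L_def)
    then have "even (L - length (w r))" using evL ev[OF r] by simp
    then obtain j where j: "L - length (w r) = 2 * j" by blast
    \<comment> \<open>All these lengths are even, so the missing letters can be supplied by cancelling pairs \<open>t t\<close>.\<close>
    let ?ts = "w r @ replicate (2 * j) t"
    have "?ts \<in> transposition_words d L"
      using w(1)[OF r] t le j by (auto simp: transposition_words_def)
    moreover have "foldr (\<circ>) ?ts id = r"
      unfolding foldr_comp_append foldr_comp_replicate_even[OF transpositions_involution[OF t]]
      using w(2)[OF r] by simp
    ultimately show "\<exists>ts\<in>transposition_words d L. foldr (\<circ>) ts id = r" by blast
  qed
qed

text \<open>The \<open>k\<close>-th power of the transition operator of the random walk, applied to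
  \<open>h\<close>. The starting point \<open>p\<close> stays variable because the argument compares
  different starting points.\<close>

definition walk_average :: "nat \<Rightarrow> ((nat \<Rightarrow> nat) \<Rightarrow> real) \<Rightarrow> nat \<Rightarrow> (nat \<Rightarrow> nat) \<Rightarrow> real" where
  "walk_average d h k p =
     (\<Sum>ts\<in>transposition_words d k. h (foldr (\<circ>) ts id \<circ> p)) / real (card (transposition_words d k))"

text \<open>The Markov property: the last \<open>l\<close> letters act on \<open>p\<close> first,
  being the right-hand factors, and the first \<open>k\<close> letters continue from there.\<close>

lemma walk_average_add:
  "walk_average d h (k + l) p =
    (\<Sum>ts\<in>transposition_words d l. walk_average d h k (foldr (\<circ>) ts id \<circ> p)) /
      real (card (transposition_words d l))"
proof -
  have split: "foldr (\<circ>) (take k ts) id \<circ> (foldr (\<circ>) (drop k ts) id \<circ> p) = foldr (\<circ>) ts id \<circ> p" for ts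
    using foldr_comp_append[of "take k ts" "drop k ts"] by (simp only: o_assoc append_take_drop_id)
  have "(\<Sum>ts\<in>transposition_words d (k + l). h (foldr (\<circ>) ts id \<circ> p)) =
      (\<Sum>(vs, us)\<in>transposition_words d l \<times> transposition_words d k.
        h (foldr (\<circ>) us id \<circ> (foldr (\<circ>) vs id \<circ> p)))"
    by (rule sum.reindex_bij_witness[of _ "\<lambda>(vs, us). us @ vs" "\<lambda>ts. (drop k ts, take k ts)"])
      (auto simp: transposition_words_def split simp del: foldr_append
        dest: in_set_takeD in_set_dropD)
  also have "\<dots> = (\<Sum>vs\<in>transposition_words d l. \<Sum>us\<in>transposition_words d k.
        h (foldr (\<circ>) us id \<circ> (foldr (\<circ>) vs id \<circ> p)))"
    by (simp add: sum.cartesian_product)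
  finally show ?thesis
    by (simp add: walk_average_def card_transposition_words power_add sum_divide_distrib mult.commute)
qed

text \<open>
  Comparing all pairs at once, rather than matching up the two sums, means that a single
  coincidence \<open>f x\<^sub>0 = g y\<^sub>0\<close> already gains a factor below 1.
\<close>

lemma average_diff_le:
  fixes f g :: "'a \<Rightarrow> real"
  assumes A: "finite A" and le: "\<And>x y. x \<in> A \<Longrightarrow> y \<in> A \<Longrightarrow> f x - g y \<le> D"
    and xy: "x\<^sub>0 \<in> A" "y\<^sub>0 \<in> A" "f x\<^sub>0 = g y\<^sub>0"
  shows "sum f A / real (card A) - sum g A / real (card A) \<le> (1 - 1 / (real (card A))\<^sup>2) * D"
proof -
  define N where "N = real (card A)"
  have N: "N > 0" using A xy by (auto simp: N_def card_gt_0_iff)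
  have "N * (sum f A - sum g A) = (\<Sum>x\<in>A. \<Sum>y\<in>A. f x - g y)"
    by (simp add: sum_subtractf N_def sum_distrib_right algebra_simps)
  also have "\<dots> = (\<Sum>(x, y)\<in>A \<times> A. f x - g y)" by (simp add: sum.cartesian_product)
  \<comment> \<open>One of the \<open>N\<^sup>2\<close> pairs contributes 0, which is the origin of
    the factor \<open>1 - 1 / N\<^sup>2\<close>.\<close>
  also have "\<dots> = (\<Sum>(x, y)\<in>A \<times> A - {(x\<^sub>0, y\<^sub>0)}. f x - g y)"
    using A xy by (subst sum.remove[of _ "(x\<^sub>0, y\<^sub>0)"]) auto
  also have "\<dots> \<le> real (card (A \<times> A - {(x\<^sub>0, y\<^sub>0)})) * D"
    by (rule sum_bounded_above) (use le in auto)
  also have "real (card (A \<times> A - {(x\<^sub>0, y\<^sub>0)})) = N\<^sup>2 - 1"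
  proof -
    have "card (A \<times> A - {(x\<^sub>0, y\<^sub>0)}) = card A * card A - 1"
      using xy A by (simp add: card_cartesian_product)
    moreover have "card A * card A \<ge> 1" using N by (simp add: N_def Suc_le_eq)
    ultimately show ?thesis by (simp add: N_def power2_eq_square of_nat_diff)
  qed
  finally have "N * (sum f A - sum g A) \<le> (N\<^sup>2 - 1) * D" .
  then have "(N * (sum f A - sum g A)) / N\<^sup>2 \<le> (N\<^sup>2 - 1) * D / N\<^sup>2"
    by (rule divide_right_mono) simp
  moreover have "(N * (sum f A - sum g A)) / N\<^sup>2 = sum f A / N - sum g A / N"
    using N by (simp add: power2_eq_square diff_divide_distrib)
  moreover have "(N\<^sup>2 - 1) * D / N\<^sup>2 = (1 - 1 / N\<^sup>2) * D"
    using N by (simp add: field_simps)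
  ultimately show ?thesis unfolding N_def by simp
qed

text \<open>Walks from \<open>p\<close> and \<open>q\<close> can meet after \<open>L\<close> steps:
  one word carries \<open>p\<close> to \<open>q\<close>, another returns \<open>q\<close> to itself.
  All words of length \<open>L\<close> have the same sign, so the endpoints of every pair of walks
  still have equal sign and \<open>D\<close> applies to them.\<close>

lemma walk_average_contraction:
  assumes L: "even L"
    "\<And>r. r permutes {1..d} \<Longrightarrow> sign r = 1 \<Longrightarrow> \<exists>ts\<in>transposition_words d L. foldr (\<circ>) ts id = r"
    and D: "\<And>p q. p permutes {1..d} \<Longrightarrow> q permutes {1..d} \<Longrightarrow> sign p = sign q \<Longrightarrow>
      walk_average d h k p - walk_average d h k q \<le> D"
    and pq: "p permutes {1..d}" "q permutes {1..d}" "sign p = sign q"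
  shows "walk_average d h (k + L) p - walk_average d h (k + L) q \<le>
    (1 - 1 / (real (card (transposition_words d L)))\<^sup>2) * D"
proof -
  have perm: "permutation p" "permutation q"
    using pq permutes_imp_permutation by blast+
  have "sign (q \<circ> inv' p) = 1"
    using pq perm by (simp add: sign_compose permutation_inverse sign_inverse)
  moreover have "q \<circ> inv' p permutes {1..d}" using pq by (intro permutes_compose permutes_inv)
  ultimately obtain us where us: "us \<in> transposition_words d L" "foldr (\<circ>) us id = q \<circ> inv' p"
    using L(2) by blast
  obtain vs where vs: "vs \<in> transposition_words d L" "foldr (\<circ>) vs id = id"
    using L(2)[of id] permutes_id by auto
  have eq: "foldr (\<circ>) us id \<circ> p = foldr (\<circ>) vs id \<circ> q"
    using us vs pq(1) by (simp add: o_assoc[symmetric] permutes_inv_o)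
  show ?thesis unfolding walk_average_add
  proof (rule average_diff_le[OF finite_transposition_words _ us(1) vs(1)])
    fix x y assume xy: "x \<in> transposition_words d L" "y \<in> transposition_words d L"
    then have s: "set x \<subseteq> transpositions d" "set y \<subseteq> transpositions d" "length x = L" "length y = L"
      by (auto simp: transposition_words_def)
    note px = word_permutes[OF s(1)] and py = word_permutes[OF s(2)]
    have pm: "permutation (foldr (\<circ>) x id)" "permutation (foldr (\<circ>) y id)"
      using px py permutes_imp_permutation by blast+
    show "walk_average d h k (foldr (\<circ>) x id \<circ> p) - walk_average d h k (foldr (\<circ>) y id \<circ> q) \<le> D"
      by (rule D) (use px py pq s pm perm in \<open>auto intro!: permutes_compose simp: sign_compose sign_word\<close>)
  qed (simp add: eq)
qed

lemma walk_average_bounds: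
  assumes "\<And>p. 0 \<le> h p" "\<And>p. h p \<le> 1"
  shows "0 \<le> walk_average d h k p" "walk_average d h k p \<le> 1"
proof -
  show "0 \<le> walk_average d h k p"
    unfolding walk_average_def using assms by (intro divide_nonneg_nonneg sum_nonneg) auto
  have "(\<Sum>ts\<in>transposition_words d k. h (foldr (\<circ>) ts id \<circ> p)) \<le> real (card (transposition_words d k)) * 1"
    by (rule sum_bounded_above) (use assms in auto)
  then show "walk_average d h k p \<le> 1"
    unfolding walk_average_def by (auto simp: divide_le_eq_1)
qed

text \<open>Each complete block of \<open>L\<close> letters gains one contraction factor; for the
  \<open>m\<close> remaining letters the trivial bound 1 is enough, as \<open>h\<close> lies between
  0 and 1.\<close>

lemma walk_average_oscillation:
  assumes h: "\<And>p. 0 \<le> h p" "\<And>p. h p \<le> 1"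
    and L: "even L"
    "\<And>r. r permutes {1..d} \<Longrightarrow> sign r = 1 \<Longrightarrow> \<exists>ts\<in>transposition_words d L. foldr (\<circ>) ts id = r"
    and pq: "p permutes {1..d}" "q permutes {1..d}" "sign p = sign q"
  shows "walk_average d h (m + j * L) p - walk_average d h (m + j * L) q \<le>
    (1 - 1 / (real (card (transposition_words d L)))\<^sup>2) ^ j"
  using pq
proof (induction j arbitrary: p q)
  case 0
  then show ?case
    using walk_average_bounds[of h d m p, OF h] walk_average_bounds[of h d m q, OF h] by simp
next
  case (Suc j)
  have "walk_average d h ((m + j * L) + L) p - walk_average d h ((m + j * L) + L) q \<le>
      (1 - 1 / (real (card (transposition_words d L)))\<^sup>2) *
      (1 - 1 / (real (card (transposition_words d L)))\<^sup>2) ^ j"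
    by (rule walk_average_contraction[OF L]) (use Suc in auto)
  moreover have "m + Suc j * L = (m + j * L) + L" by simp
  ultimately show ?case by (simp only: power_Suc)
qed

text \<open>Left multiplication by the value of a word permutes the symmetric group, so the uniform
  distribution is stationary. For \<open>d \<ge> 2\<close> there are words of every length, so no
  average divides by zero.\<close>

lemma sum_walk_average:
  assumes "d \<ge> 2"
  shows "(\<Sum>p | p permutes {1..d}. walk_average d h k p) = (\<Sum>p | p permutes {1..d}. h p)"
proof -
  let ?W = "transposition_words d k" and ?S = "{p. p permutes {1..d}}"
  have "card ?W \<noteq> 0" using assms by (simp add: card_transposition_words)
  have "(\<Sum>p\<in>?S. \<Sum>ts\<in>?W. h (foldr (\<circ>) ts id \<circ> p)) = (\<Sum>ts\<in>?W. \<Sum>p\<in>?S. h (foldr (\<circ>) ts id \<circ> p))"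
    by (rule sum.swap)
  also have "\<dots> = (\<Sum>ts\<in>?W. \<Sum>p\<in>?S. h p)"
  proof (rule sum.cong)
    fix ts assume "ts \<in> ?W"
    then have "foldr (\<circ>) ts id permutes {1..d}"
      by (intro word_permutes) (auto simp: transposition_words_def)
    then show "(\<Sum>p\<in>?S. h (foldr (\<circ>) ts id \<circ> p)) = (\<Sum>p\<in>?S. h p)"
      by (rule setum_permutations_compose_left[symmetric])
  qed simp
  finally show ?thesis using \<open>card ?W \<noteq> 0\<close>
    by (simp add: walk_average_def sum_divide_distrib[symmetric])
qed

lemma card_even_perms:
  assumes "d \<ge> 2"
  shows "real (card {p. p permutes {1..d} \<and> sign p = 1}) = fact d / 2"
proof -
  have "{p. p permutes {1..d} \<and> sign p = 1} = carrier (alt_group d)"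
    by (auto simp: alt_group_carrier sign_def split: if_splits)
  moreover have "2 * card (carrier (alt_group d)) = fact d"
    using alt_group_card_carrier assms by simp
  then have "2 * real (card (carrier (alt_group d))) = fact d" by (metis of_nat_fact of_nat_mult of_nat_numeral)
  ultimately show ?thesis by simp
qed

text \<open>The proportion in question is the average started at \<open>id\<close>. Over even
  starting points the averages become nearly equal and add up to exactly \<open>card C\<close>; as
  there are d!/2 such points, each average is close to 2 |C| / d!.\<close>

theorem transposition_words_equidistribute:
  assumes d: "d \<ge> 2" and C: "\<And>p. p \<in> C \<Longrightarrow> p permutes {1..d}" "\<And>p. p \<in> C \<Longrightarrow> sign p = s"
    and k: "filterlim k at_top F" "\<And>g. (-1) ^ k g = s"
  shows "((\<lambda>g. real (card {ts \<in> transposition_words d (k g). foldr (\<circ>) ts id \<in> C}) /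
    real (d choose 2) ^ k g) \<longlongrightarrow> 2 * real (card C) / fact d) F"
proof -
  obtain L where L: "L > 0" "even L"
    "\<And>r. r permutes {1..d} \<Longrightarrow> sign r = 1 \<Longrightarrow> \<exists>ts\<in>transposition_words d L. foldr (\<circ>) ts id = r"
    using exists_uniform_word_length[OF d] by blast
  define h where "h = (\<lambda>p. of_bool (p \<in> C) :: real)"
  have h: "0 \<le> h p" "h p \<le> 1" for p by (auto simp: h_def)
  define a where "a = walk_average d h"
  define c where "c = 1 - 1 / (real (card (transposition_words d L)))\<^sup>2"
  define E where "E = {p. p permutes {1..d} \<and> sign p = 1}"
  \<comment> \<open>Since \<open>k\<close> is \<open>k mod L + (k div L) * L\<close>, the exponent
    counts the contracting blocks.\<close>
  define \<delta> where "\<delta> = (\<lambda>k. c ^ (k div L))"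
  have cardE: "real (card E) = fact d / 2" unfolding E_def by (rule card_even_perms[OF d])
  have finE: "finite E"
    by (rule finite_subset[OF _ finite_permutations[of "{1..d}"]]) (auto simp: E_def)
  have osc: "\<bar>a k p - a k q\<bar> \<le> \<delta> k" if "p \<in> E" "q \<in> E" for k p q
  proof -
    have "a k p - a k q \<le> c ^ (k div L)" if "p \<in> E" "q \<in> E" for p q
      using walk_average_oscillation[where h = h, OF h L(2,3), of p q "k mod L" "k div L"] that
      by (simp add: a_def c_def E_def)
    from this[OF that] this[OF that(2,1)]
    have "a k p - a k q \<le> c ^ (k div L)" "a k q - a k p \<le> c ^ (k div L)" .
    then show ?thesis by (simp add: \<delta>_def)
  qed
  have sumE: "(\<Sum>p\<in>E. a (k g) p) = real (card C)" for g
  proof -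
    \<comment> \<open>From an odd starting point the walk ends with sign \<open>-s\<close>, hence
      outside \<open>C\<close>; the whole sum is carried by even starting points.\<close>
    have "a (k g) p = 0" if "p permutes {1..d}" "p \<notin> E" for p
    proof -
      have sp: "sign p \<noteq> 1" using that by (simp add: E_def)
      have "h (foldr (\<circ>) ts id \<circ> p) = 0" if "ts \<in> transposition_words d (k g)" for ts
      proof -
        have ts: "set ts \<subseteq> transpositions d" "length ts = k g" using that by (auto simp: transposition_words_def)
        have "permutation (foldr (\<circ>) ts id)" "permutation p"
          using word_permutes[OF ts(1)] \<open>p permutes _\<close> permutes_imp_permutation by blast+
        then have "sign (foldr (\<circ>) ts id \<circ> p) = s * sign p"
          using sign_word[OF ts(1)] ts(2) k(2) by (simp add: sign_compose)
        moreover have "s \<noteq> 0" using k(2)[of g] by auto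
        ultimately have "sign (foldr (\<circ>) ts id \<circ> p) \<noteq> s" using sp by simp
        then show ?thesis using C(2) by (auto simp: h_def)
      qed
      then show ?thesis by (simp add: a_def walk_average_def)
    qed
    then have "(\<Sum>p\<in>E. a (k g) p) = (\<Sum>p | p permutes {1..d}. a (k g) p)"
      by (intro sum.mono_neutral_left finite_permutations) (auto simp: E_def)
    also have "\<dots> = (\<Sum>p | p permutes {1..d}. h p)"
      unfolding a_def by (rule sum_walk_average[OF d])
    also have "\<dots> = real (card C)"
    proof -
      have "{p. p permutes {1..d}} \<inter> C = C" using C(1) by auto
      then show ?thesis unfolding h_def
        by (simp add: sum_of_bool_eq finite_permutations)
    qed
    finally show ?thesis .
  qed
  have idE: "id \<in> E" by (simp add: E_def permutes_id)
  have bound: "\<bar>a (k g) id - 2 * real (card C) / fact d\<bar> \<le> \<delta> (k g)" for g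
  proof -
    have pos: "real (card E) > 0" unfolding cardE by simp
    have "2 * real (card C) / fact d = real (card C) / real (card E)" unfolding cardE by simp
    then have "real (card E) * \<bar>a (k g) id - 2 * real (card C) / fact d\<bar>
        = \<bar>real (card E) * (a (k g) id - real (card C) / real (card E))\<bar>"
      by (simp only: abs_mult abs_of_nat)
    also have "\<dots> = \<bar>real (card E) * a (k g) id - real (card C)\<bar>"
      using pos by (simp add: right_diff_distrib)
    also have "\<dots> = \<bar>\<Sum>p\<in>E. a (k g) id - a (k g) p\<bar>" by (simp add: sum_subtractf sumE)
    also have "\<dots> \<le> (\<Sum>p\<in>E. \<bar>a (k g) id - a (k g) p\<bar>)" by (rule sum_abs)
    also have "\<dots> \<le> real (card E) * \<delta> (k g)"
      by (rule sum_bounded_above) (use osc idE in auto)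
    finally show ?thesis using pos by (simp only: mult_le_cancel_left_pos)
  qed
  have c: "0 \<le> c" "c < 1"
  proof -
    have "card (transposition_words d L) > 0" using d by (simp add: card_transposition_words)
    then have "real (card (transposition_words d L)) \<ge> 1" by linarith
    then show "0 \<le> c" "c < 1" by (auto simp: c_def divide_le_eq_1)
  qed
  have "filterlim (\<lambda>k. k div L) at_top at_top"
  proof (rule filterlim_at_top[THEN iffD2], intro allI)
    fix Z
    show "\<forall>\<^sub>F x in at_top. Z \<le> x div L"
      using eventually_ge_at_top[of "Z * L"]
      by eventually_elim (use L(1) in \<open>simp add: less_eq_div_iff_mult_less_eq\<close>)
  qed
  then have "filterlim (\<lambda>g. k g div L) at_top F" using k(1) by (rule filterlim_compose)
  moreover have "(\<lambda>n. c ^ n) \<longlonglongrightarrow> 0" using c by (intro LIMSEQ_realpow_zero)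
  ultimately have "((\<lambda>g. \<delta> (k g)) \<longlongrightarrow> 0) F"
    unfolding \<delta>_def using filterlim_compose by blast
  then have "((\<lambda>g. a (k g) id - 2 * real (card C) / fact d) \<longlongrightarrow> 0) F"
    by (rule tendsto_0_le[where K = 1])
      (auto intro!: always_eventually order_trans[OF bound abs_ge_self])
  then have "((\<lambda>g. a (k g) id) \<longlongrightarrow> 2 * real (card C) / fact d) F"
    by (simp add: LIM_zero_iff)
  moreover have "a (k g) id = real (card {ts \<in> transposition_words d (k g). foldr (\<circ>) ts id \<in> C}) /
      real (d choose 2) ^ k g" for g
  proof -
    have "(\<Sum>ts\<in>transposition_words d (k g). h (foldr (\<circ>) ts id)) =
        real (card {ts \<in> transposition_words d (k g). foldr (\<circ>) ts id \<in> C})"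
      unfolding h_def by (simp add: sum_of_bool_eq finite_transposition_words Int_def)
    then show ?thesis by (simp add: a_def walk_average_def card_transposition_words)
  qed
  ultimately show ?thesis by simp
qed

section \<open>Asymptotics of Hurwitz numbers\<close>

lemma transitive_generate_transpositions:
  "transitive_subgroup d (generate (sym_group d) (transpositions d))"
  unfolding transitive_subgroup_def
proof (intro conjI ballI)
  interpret group "sym_group d" by (rule sym_group_is_group)
  show "subgroup (generate (sym_group d) (transpositions d)) (sym_group d)"
    by (rule generate_is_subgroup) (auto simp only: sym_group_carrier transpositions_permutes subset_iff)
  fix x y assume xy: "x \<in> {1..d}" "y \<in> {1..d}"
  show "\<exists>p\<in>generate (sym_group d) (transpositions d). p x = y"
  proof (cases "x = y")
    case True
    moreover have "id \<in> generate (sym_group d) (transpositions d)"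
      using generate.one[of "sym_group d"] unfolding sym_group_one .
    ultimately show ?thesis by (intro bexI[of _ id]) simp_all
  next
    case False
    then have "transpose x y \<in> transpositions d" using xy unfolding transpositions_def by blast
    then show ?thesis by (intro bexI[of _ "transpose x y"]) (auto intro: generate.incl)
  qed
qed

lemma card_words_missing_transposition:
  "card {ts \<in> transposition_words d k. set ts \<noteq> transpositions d} \<le>
    (d choose 2) * ((d choose 2) - 1) ^ k"
proof -
  let ?T = "transpositions d"
  have "{ts \<in> transposition_words d k. set ts \<noteq> ?T} \<subseteq>
      (\<Union>t\<in>?T. {ts. set ts \<subseteq> ?T - {t} \<and> length ts = k})"
    by (auto simp: transposition_words_def)
  then have "card {ts \<in> transposition_words d k. set ts \<noteq> ?T} \<le>
      card (\<Union>t\<in>?T. {ts. set ts \<subseteq> ?T - {t} \<and> length ts = k})"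
    by (intro card_mono finite_UN_I finite_lists_length_eq) (auto simp: finite_transpositions)
  also have "\<dots> \<le> (\<Sum>t\<in>?T. card {ts. set ts \<subseteq> ?T - {t} \<and> length ts = k})"
    by (rule card_UN_le[OF finite_transpositions])
  also have "\<dots> = (\<Sum>t\<in>?T. ((d choose 2) - 1) ^ k)"
    by (rule sum.cong) (simp_all add: card_lists_length_eq finite_transpositions card_transpositions)
  finally show ?thesis by (simp add: card_transpositions)
qed

lemma hurwitz_tuples_subset:
  "hurwitz_tuples g \<mu> \<subseteq> {ts \<in> transposition_words (sum_list \<mu>) (num_branch g \<mu>).
     foldr (\<circ>) ts id \<in> perms_of_type (sum_list \<mu>) (mset \<mu>)}"
  using word_permutes by (auto simp only: hurwitz_tuples_def transposition_words_def perms_of_type_def)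

text \<open>
  Transitivity can only fail for tuples in which some transposition does not occur, and these are
  exponentially rare.
\<close>

lemma hurwitz_tuples_superset:
  "{ts \<in> transposition_words (sum_list \<mu>) (num_branch g \<mu>).
     foldr (\<circ>) ts id \<in> perms_of_type (sum_list \<mu>) (mset \<mu>)} \<subseteq>
   hurwitz_tuples g \<mu> \<union>
   {ts \<in> transposition_words (sum_list \<mu>) (num_branch g \<mu>). set ts \<noteq> transpositions (sum_list \<mu>)}"
  using transitive_generate_transpositions[of "sum_list \<mu>"]
  by (auto simp only: hurwitz_tuples_def transposition_words_def perms_of_type_def)

lemma filterlim_num_branch: "filterlim (\<lambda>g. num_branch g \<mu>) at_top at_top"
proof (rule filterlim_at_top_mono[OF filterlim_ident])
  show "\<forall>\<^sub>F g in at_top. g \<le> num_branch g \<mu>"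
    using eventually_ge_at_top[of 2] by eventually_elim (simp add: num_branch_def)
qed

text \<open>A squeeze: omitting transitivity gives the upper bound, subtracting the words that miss
  a transposition the lower one. By a union bound over the missing letter, their proportion is at
  most \<open>T * ((T - 1) / T) ^ k g\<close>.\<close>

lemma hurwitz_tuples_asymptotics:
  assumes pos: "0 \<notin> set \<mu>" "\<mu> \<noteq> []" and d: "sum_list \<mu> = d" "d \<ge> 2"
  shows "((\<lambda>g. real (card (hurwitz_tuples g \<mu>)) / real (d choose 2) ^ num_branch g \<mu>) \<longlongrightarrow>
    2 * real (card (perms_of_type d (mset \<mu>))) / fact d) at_top"
proof -
  define T where "T = d choose 2"
  define k where "k = (\<lambda>g. num_branch g \<mu>)"
  define N where "N g = card {ts \<in> transposition_words d (k g).
    foldr (\<circ>) ts id \<in> perms_of_type d (mset \<mu>)}" for g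
  have T: "T \<ge> 1" using d(2) by (simp add: T_def Suc_le_eq)
  have k: "filterlim k at_top at_top" unfolding k_def by (rule filterlim_num_branch)
  have lenpos: "length \<mu> \<ge> 1" using pos(2) by (cases \<mu>) auto
  have sgn: "(-1 :: int) ^ k g = (-1) ^ (d + length \<mu>)" for g
  proof -
    \<comment> \<open>Adding 2 on the left undoes the truncated subtraction in
      \<open>num_branch\<close>.\<close>
    have "k g + 2 = d + length \<mu> + 2 * g" using d lenpos by (simp add: k_def num_branch_def)
    then have "even (k g) \<longleftrightarrow> even (d + length \<mu>)" by presburger
    then show ?thesis by (simp add: minus_one_power_iff)
  qed
  have lim: "((\<lambda>g. real (N g) / real T ^ k g) \<longlongrightarrow>
      2 * real (card (perms_of_type d (mset \<mu>))) / fact d) at_top"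
    unfolding N_def T_def
    by (rule transposition_words_equidistribute[OF d(2) _ sign_perms_of_type[OF pos(1)] k sgn])
      (simp_all only: perms_of_type_def mem_Collect_eq)
  have "((\<lambda>g. real T * (real (T - 1) / real T) ^ k g) \<longlongrightarrow> real T * 0) at_top"
  proof (rule tendsto_mult_left)
    have "(\<lambda>n. (real (T - 1) / real T) ^ n) \<longlonglongrightarrow> 0"
      using T by (intro LIMSEQ_realpow_zero) auto
    then show "((\<lambda>g. (real (T - 1) / real T) ^ k g) \<longlongrightarrow> 0) at_top"
      using k by (rule filterlim_compose)
  qed
  from tendsto_diff[OF lim this]
  have lower: "((\<lambda>g. real (N g) / real T ^ k g - real T * (real (T - 1) / real T) ^ k g) \<longlongrightarrow>
      2 * real (card (perms_of_type d (mset \<mu>))) / fact d) at_top" by simp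
  have fin: "finite {ts \<in> transposition_words d (k g). P ts}" for g P
    using finite_transposition_words by simp
  have finH: "finite (hurwitz_tuples g \<mu>)" for g
    by (rule finite_subset[OF hurwitz_tuples_subset]) (use fin d k_def in auto)
  have le: "card (hurwitz_tuples g \<mu>) \<le> N g" for g
    unfolding N_def
    by (rule card_mono[OF fin]) (use hurwitz_tuples_subset[of g \<mu>] d(1) in \<open>simp only: k_def\<close>)
  have ge: "N g \<le> card (hurwitz_tuples g \<mu>) + T * (T - 1) ^ k g" for g
  proof -
    have "N g \<le> card (hurwitz_tuples g \<mu> \<union> {ts \<in> transposition_words d (k g). set ts \<noteq> transpositions d})"
      unfolding N_def
      by (rule card_mono) (use hurwitz_tuples_superset[of \<mu> g] d(1) finH fin in \<open>simp_all only: k_def finite_Un simp_thms\<close>)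
    also have "\<dots> \<le> card (hurwitz_tuples g \<mu>) +
        card {ts \<in> transposition_words d (k g). set ts \<noteq> transpositions d}"
      by (rule card_Un_le)
    finally show ?thesis using card_words_missing_transposition[of d "k g"] unfolding T_def by linarith
  qed
  show ?thesis unfolding T_def[symmetric] k_def[symmetric]
  proof (rule tendsto_sandwich[OF _ _ lower lim])
    show "\<forall>\<^sub>F g in at_top. real (N g) / real T ^ k g - real T * (real (T - 1) / real T) ^ k g
        \<le> real (card (hurwitz_tuples g \<mu>)) / real T ^ num_branch g \<mu>"
    proof (rule always_eventually, rule allI)
      fix g
      have "real (N g) \<le> real (card (hurwitz_tuples g \<mu>) + T * (T - 1) ^ k g)"
        using ge[of g] by (simp only: of_nat_le_iff)
      then have "real (N g) / real T ^ k g \<le>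
          (real (card (hurwitz_tuples g \<mu>)) + real T * real (T - 1) ^ k g) / real T ^ k g"
        by (intro divide_right_mono) (simp_all only: of_nat_add of_nat_mult of_nat_power, simp)
      then show "real (N g) / real T ^ k g - real T * (real (T - 1) / real T) ^ k g
          \<le> real (card (hurwitz_tuples g \<mu>)) / real T ^ num_branch g \<mu>"
        unfolding k_def by (simp add: add_divide_distrib power_divide)
    qed
    show "\<forall>\<^sub>F g in at_top. real (card (hurwitz_tuples g \<mu>)) / real T ^ num_branch g \<mu>
        \<le> real (N g) / real T ^ k g"
      using le by (intro always_eventually allI) (simp add: k_def divide_right_mono)
  qed
qed

theorem theorem1p6:
  fixes \<mu> :: "nat list" and n d :: nat
  assumes "\<forall>m\<in>set \<mu>. m > 0"
    and "length \<mu> = n" and "n \<ge> 1"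
    and "sum_list \<mu> = d"
  shows "(\<lambda>g. hurwitz g \<mu>) \<sim>[at_top]
         (\<lambda>g. 2 / (fact d * real (prod_list \<mu>)) * real (d choose 2) ^ (d + 2 * g + n - 2))"
proof (cases "d \<ge> 2")
  case True
  have pos: "0 \<notin> set \<mu>" using assms(1) by auto
  have ne: "\<mu> \<noteq> []" using assms(2,3) by auto
  define A P C where "A = real (card (tuple_Aut \<mu>))" and "P = real (prod_list \<mu>)"
    and "C = real (card (perms_of_type d (mset \<mu>)))"
  have A: "A > 0" using tuple_Aut_pos[of \<mu>] by (simp add: A_def)
  have P: "P > 0" using pos by (simp add: P_def prod_list_zero_iff flip: neq0_conv)
  have CAP: "C * (A * P) = fact d"
    using arg_cong[OF card_perms_of_type[OF pos assms(4)], of real] by (simp add: A_def P_def C_def)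
  have T: "real (d choose 2) > 0" using True by simp
  have k: "d + 2 * g + n - 2 = num_branch g \<mu>" for g
    using assms by (simp add: num_branch_def)
  \<comment> \<open>By \<open>CAP\<close>, the factor \<open>A * P / 2\<close> is the reciprocal of
    the limit \<open>2 * C / fact d\<close>.\<close>
  have "((\<lambda>g. A * P / 2 * (real (card (hurwitz_tuples g \<mu>)) / real (d choose 2) ^ num_branch g \<mu>))
      \<longlongrightarrow> A * P / 2 * (2 * C / fact d)) at_top"
    unfolding C_def by (intro tendsto_mult_left hurwitz_tuples_asymptotics pos ne assms True)
  moreover have "A * P / 2 * (2 * C / fact d) = 1"
    using CAP by (simp add: divide_eq_eq mult_ac)
  moreover have "A * P / 2 * (real (card (hurwitz_tuples g \<mu>)) / real (d choose 2) ^ num_branch g \<mu>) =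
      hurwitz g \<mu> / (2 / (fact d * P) * real (d choose 2) ^ num_branch g \<mu>)" for g
    unfolding hurwitz_def assms(4) A_def[symmetric] using P T by (simp add: field_simps)
  ultimately show ?thesis
    unfolding k P_def[symmetric] by (intro asymp_equivI') (simp only:)
next
  case False
  \<comment> \<open>Both sides vanish for large \<open>g\<close> when \<open>d = 1\<close>.\<close>
  then have d: "d choose 2 = 0" by (simp add: binomial_eq_0)
  show ?thesis
  proof (rule asymp_equiv_refl_ev)
    \<comment> \<open>Equality is only eventual: for \<open>d = 1\<close> and \<open>g = 0\<close>
      the empty tuple makes the left side 1, while \<open>0 ^ 0 = 1\<close> makes the right side
      2.\<close>
    show "\<forall>\<^sub>F g in at_top. hurwitz g \<mu> =
        2 / (fact d * real (prod_list \<mu>)) * real (d choose 2) ^ (d + 2 * g + n - 2)"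
      using eventually_ge_at_top[of 2]
    proof eventually_elim
      case (elim g)
      have "num_branch g \<mu> > 0" using elim by (simp add: num_branch_def)
      then have "card (transposition_words d (num_branch g \<mu>)) = 0"
        unfolding card_transposition_words d by (rule zero_power)
      then have "transposition_words d (num_branch g \<mu>) = {}"
        using finite_transposition_words by simp
      then have "hurwitz_tuples g \<mu> = {}" using hurwitz_tuples_subset[of g \<mu>] assms(4) by auto
      then show ?case using d elim by (simp add: hurwitz_def)
    qed
  qed
qed

end
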